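(* Let $X, Y, Z$ be real locally convex topological linear spaces, $C \subseteq Z$ and $D \subseteq Y$ convex cones containing $0$ with $C^+ \neq \{0\}$, and let $f \colon X \to \mathcal G(Z,C)$ and $g \colon X \to \mathcal G(Y,D)$ be functions. Consider the problem (PC) of minimizing $f(x)$ subject to $0 \in g(x)$, with feasible set $\mathcal X = \{x \in X \mid 0 \in g(x)\}$. Let $M \subseteq \mathcal X$ be a non-empty set. Assume that for each $z^* \in C^+\setminus\{0\}$ there is $y^* \in D^+$ satisfying $$\hat f(0; M) \oplus \inf_{y \in \hat g(0; M)} S_{(y^*, z^* )}(y) = \inf_{x \in X} L(x, y^*, z^* )$$ and $$\inf_{y \in \hat g(0; M)} S_{(y^*, z^* )}(y) = H^+(z^* ).$$ Then $M$ is an infimizer for (PC), i.e. $\inf\{f(x) \mid x \in M\} = \inf\{f(x) \mid x \in \mathcal X\}$ in $\mathcal G(Z,C)$.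
   Context: For a convex cone $C\subseteq Z$, $C^+ = \{z^* \in Z^* \mid \forall z \in C\colon z^*(z)\ge 0\}$ ($Z^*$ the topological dual); $D^+\subseteq Y^*$ analogously. $\mathcal G(Z,C) = \{A \subseteq Z \mid A = \operatorname{cl}\operatorname{co}(A+C)\}$, ordered by $\supseteq$ (so $A$ is "less than or equal to" $B$ iff $A \supseteq B$); $\mathcal G(Y,D)$ analogously. Minkowski addition satisfies $A+\emptyset=\emptyset$; $A \oplus B = \operatorname{cl}(A+B)$. Infima are taken in this lattice: $\inf \mathcal A = \operatorname{cl}\operatorname{co}\bigcup_{A\in\mathcal A} A$ (with $\inf \emptyset = \emptyset$). $H^+(z^* ) = \{z \in Z\mid z^*(z)\ge 0\}$, and for $y^* \in Y^*$, $z^* \in Z^*$: $S_{(y^*,z^* )}(y) = \{z \in Z \mid y^*(y) \le z^*(z)\}$ for $y \in Y$. Inf-translation: for non-empty $M \subseteq X$, $\hat f(x;M) = \inf_{u\in M} f(x+u) = \operatorname{cl}\operatorname{co}\bigcup_{u \in M} f(x+u)$, and $\hat g(x;M) = \operatorname{cl}\operatorname{co}\bigcup_{u\in M} g(x+u)$. Lagrangian: $L(x,y^*,z^* ) = f(x) \oplus \inf\{S_{(y^*,z^* )}(y) \mid y \in g(x)\}$ for $x \in X$, $y^* \in Y^*$, $z^* \in C^+\setminus\{0\}$. *)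

theory Defs
  imports "HOL-Analysis.Analysis"
begin

text \<open>Real locally convex topological linear spaces. No separation axiom is assumed.\<close>

class topological_real_vector = real_vector + topological_ab_group_add +
  assumes tendsto_scaleR_Pair:
    "filterlim (\<lambda>p :: real \<times> 'a. fst p *\<^sub>R snd p) (nhds (c *\<^sub>R x)) (nhds c \<times>\<^sub>F nhds x)"

text \<open>
  The constant \<^const>\<open>convex\<close> cannot occur in a class assumption because of its sort
  constraint, so its definition is written out here and folded in the lemma below.
\<close>

class locally_convex_space = topological_real_vector +
  assumes convex_neighbourhood:
    "open U \<Longrightarrow> x \<in> U \<Longrightarrow>
      \<exists>V. open V \<and> (\<forall>a\<in>V. \<forall>b\<in>V. \<forall>u\<ge>0. \<forall>v\<ge>0. u + v = 1 \<longrightarrow> u *\<^sub>R a + v *\<^sub>R b \<in> V) \<and>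
          x \<in> V \<and> V \<subseteq> U"

lemma locally_convex:
  fixes x :: "'a::locally_convex_space"
  assumes "open U" "x \<in> U"
  shows "\<exists>V. open V \<and> convex V \<and> x \<in> V \<and> V \<subseteq> U"
  using convex_neighbourhood[OF assms] unfolding convex_def .

instance real_normed_vector \<subseteq> locally_convex_space
proof
  fix c :: real and x :: 'a
  show "filterlim (\<lambda>p. fst p *\<^sub>R snd p) (nhds (c *\<^sub>R x)) (nhds c \<times>\<^sub>F nhds x)"
    by (intro tendsto_scaleR filterlim_fst filterlim_snd)
next
  fix U :: "'a set" and x :: 'a
  assume "open U" "x \<in> U"
  then obtain e where "e > 0" "ball x e \<subseteq> U"
    by (rule openE)
  then have "\<exists>V. open V \<and> convex V \<and> x \<in> V \<and> V \<subseteq> U"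
    by (intro exI[of _ "ball x e"]) auto
  then show "\<exists>V. open V \<and> (\<forall>a\<in>V. \<forall>b\<in>V. \<forall>u\<ge>0. \<forall>v\<ge>0. u + v = 1 \<longrightarrow> u *\<^sub>R a + v *\<^sub>R b \<in> V) \<and>
      x \<in> V \<and> V \<subseteq> U"
    unfolding convex_def .
qed

definition topological_dual :: "('a::topological_real_vector \<Rightarrow> real) set" where
  "topological_dual = {\<phi>. linear \<phi> \<and> continuous_on UNIV \<phi>}"

definition dual_cone :: "'a::topological_real_vector set \<Rightarrow> ('a \<Rightarrow> real) set" where
  "dual_cone C = {\<phi> \<in> topological_dual. \<forall>z\<in>C. 0 \<le> \<phi> z}"

text \<open>
  The order on \<open>\<G> C\<close> is \<open>\<supseteq>\<close>, so infima are closed convex hulls of unions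
  and \<open>\<G>_inf {} = {}\<close>. The sum \<open>A + B\<close> of sets is the Minkowski sum from
  \<^theory>\<open>HOL-Library.Set_Algebras\<close>; in particular \<open>A + {} = {}\<close>.
\<close>

definition \<G> :: "'a::topological_real_vector set \<Rightarrow> 'a set set" where
  "\<G> C = {A. A = closure (convex hull (A + C))}"

definition \<G>_inf :: "'a::topological_real_vector set set \<Rightarrow> 'a set" where
  "\<G>_inf \<A> = closure (convex hull (\<Union>\<A>))"

definition closed_sum :: "'a::topological_real_vector set \<Rightarrow> 'a set \<Rightarrow> 'a set"
    (infixl \<open>\<oplus>\<^sub>c\<^sub>l\<close> 65) where
  "A \<oplus>\<^sub>c\<^sub>l B = closure (A + B)"

definition H_plus :: "('z \<Rightarrow> real) \<Rightarrow> 'z set" where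
  "H_plus zs = {z. 0 \<le> zs z}"

definition S_map :: "('y \<Rightarrow> real) \<Rightarrow> ('z \<Rightarrow> real) \<Rightarrow> 'y \<Rightarrow> 'z set" where
  "S_map ys zs y = {z. ys y \<le> zs z}"

definition inf_translation ::
    "('x::plus \<Rightarrow> 'a::topological_real_vector set) \<Rightarrow> 'x \<Rightarrow> 'x set \<Rightarrow> 'a set" where
  "inf_translation f x M = \<G>_inf ((\<lambda>u. f (x + u)) ` M)"

definition Lagrangian ::
    "('x \<Rightarrow> 'z::topological_real_vector set) \<Rightarrow> ('x \<Rightarrow> 'y set) \<Rightarrow>
     'x \<Rightarrow> ('y \<Rightarrow> real) \<Rightarrow> ('z \<Rightarrow> real) \<Rightarrow> 'z set" where
  "Lagrangian f g x ys zs = f x \<oplus>\<^sub>c\<^sub>l \<G>_inf (S_map ys zs ` g x)"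

definition feasible_set :: "('x \<Rightarrow> 'y::zero set) \<Rightarrow> 'x set" where
  "feasible_set g = {x. 0 \<in> g x}"

definition infimizer ::
    "('x \<Rightarrow> 'z::topological_real_vector set) \<Rightarrow> ('x \<Rightarrow> 'y::zero set) \<Rightarrow> 'x set \<Rightarrow> bool" where
  "infimizer f g M \<longleftrightarrow> \<G>_inf (f ` M) = \<G>_inf (f ` feasible_set g)"

end

theory Submission
  imports Defs
begin

text \<open>
  If a point \<open>z\<close> of some \<open>f x\<close> with \<open>x\<close> feasible lay outside the closed convex set
  \<open>\<G>_inf (f ` M)\<close>, Hahn-Banach would give a continuous linear \<open>\<phi>\<close> and a number \<open>c\<close> with
  \<open>\<phi> z < c \<le> \<phi>\<close> on \<open>\<G>_inf (f ` M)\<close>. Since the values of \<open>f\<close> absorb \<open>C\<close>, \<open>\<phi> \<in> dual_cone C\<close>,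
  and the hypothesis for \<open>zs = \<phi>\<close> puts the Lagrangian at \<open>x\<close>, which contains \<open>f x\<close>, inside
  \<open>{\<phi> \<ge> c}\<close>.

  The separation theorem is obtained from the fact that the minimal sublinear functionals on a
  real vector space are the linear ones, so that Zorn's lemma is applied to sublinear functionals
  instead of partial linear extensions.
\<close>

section \<open>Linear minorants of sublinear functionals\<close>

definition sublinear :: "('a::real_vector \<Rightarrow> real) \<Rightarrow> bool" where
  "sublinear p \<longleftrightarrow> (\<forall>x y. p (x + y) \<le> p x + p y) \<and> (\<forall>t>0. \<forall>x. p (t *\<^sub>R x) = t * p x)"

text \<open>One inequality for scaling suffices: applied with factor \<open>inverse t\<close> at
  \<open>t *\<^sub>R x\<close> it returns the reverse one.\<close>

lemma sublinearI:
  assumes add: "\<And>x y. p (x + y) \<le> p x + p y"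
    and scale: "\<And>t x. 0 < t \<Longrightarrow> p (t *\<^sub>R x) \<le> t * p x"
  shows "sublinear p"
proof -
  have "p (t *\<^sub>R x) = t * p x" if "0 < t" for t x
  proof (rule antisym[OF scale[OF that]])
    have "p (inverse t *\<^sub>R (t *\<^sub>R x)) \<le> inverse t * p (t *\<^sub>R x)"
      by (rule scale) (use that in simp)
    then show "t * p x \<le> p (t *\<^sub>R x)"
      using that by (simp add: field_simps)
  qed
  then show ?thesis
    using add by (simp add: sublinear_def)
qed

lemma sublinear_add: "sublinear p \<Longrightarrow> p (x + y) \<le> p x + p y"
  by (simp add: sublinear_def)

lemma sublinear_scale: "sublinear p \<Longrightarrow> 0 < t \<Longrightarrow> p (t *\<^sub>R x) = t * p x"
  by (simp add: sublinear_def)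

lemma sublinear_zero: "sublinear p \<Longrightarrow> p 0 = 0"
  using sublinear_scale[of p 2 0] by simp

lemma sublinear_scale_nonneg: "sublinear p \<Longrightarrow> 0 \<le> t \<Longrightarrow> p (t *\<^sub>R x) = t * p x"
  by (cases "t = 0") (auto simp: sublinear_zero sublinear_scale)

lemma sublinear_ge_minus: "sublinear p \<Longrightarrow> - p (- x) \<le> p x"
  using sublinear_add[of p x "- x"] sublinear_zero[of p] by simp

text \<open>Take \<open>q x\<close> as the infimum of \<open>p (x + t *\<^sub>R y) - t * p y\<close>
  over \<open>t \<ge> 0\<close>: \<open>t = 0\<close> gives \<open>q \<le> p\<close>, and
  \<open>t = 1\<close> at \<open>- y\<close> gives the last bound. At a minimal functional this
  forces oddness; at a general \<open>p\<close> it makes a linear minorant touch \<open>p\<close> at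
  \<open>y\<close>.\<close>

lemma sublinear_tilt:
  assumes p: "sublinear p"
  shows "\<exists>q. sublinear q \<and> (\<forall>x. q x \<le> p x) \<and> q (- y) \<le> - p y"
proof -
  define S where "S x = (\<lambda>t. p (x + t *\<^sub>R y) - t * p y) ` {0..}" for x
  define q where "q x = Inf (S x)" for x
  have bdd: "bdd_below (S x)" for x
  proof (rule bdd_belowI)
    fix s assume "s \<in> S x"
    then obtain t where t: "t \<ge> 0" "s = p (x + t *\<^sub>R y) - t * p y"
      by (auto simp: S_def)
    have "p (t *\<^sub>R y) \<le> p (x + t *\<^sub>R y) + p (- x)"
      using sublinear_add[OF p, of "x + t *\<^sub>R y" "- x"] by simp
    then show "- p (- x) \<le> s"
      using t sublinear_scale_nonneg[OF p] by simp
  qed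
  have ne: "S x \<noteq> {}" for x
    by (auto simp: S_def)
  have le: "q x \<le> p (x + t *\<^sub>R y) - t * p y" if "t \<ge> 0" for x t
    unfolding q_def by (rule cInf_lower[OF _ bdd]) (use that in \<open>auto simp: S_def\<close>)
  have "sublinear q"
  proof (rule sublinearI)
    fix a b
    \<comment> \<open>Parameters \<open>t\<close> for \<open>a\<close> and \<open>u\<close> for
      \<open>b\<close> combine to \<open>t + u\<close> for \<open>a + b\<close>; the infima over
      \<open>r\<close> and then \<open>s\<close> are taken one at a time.\<close>
    have "q (a + b) - s \<le> r" if "s \<in> S a" "r \<in> S b" for s r
    proof -
      obtain t where t: "t \<ge> 0" "s = p (a + t *\<^sub>R y) - t * p y"
        using \<open>s \<in> S a\<close> by (auto simp: S_def)
      obtain u where u: "u \<ge> 0" "r = p (b + u *\<^sub>R y) - u * p y"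
        using \<open>r \<in> S b\<close> by (auto simp: S_def)
      have "q (a + b) \<le> p ((a + b) + (t + u) *\<^sub>R y) - (t + u) * p y"
        by (rule le) (use t u in simp)
      also have "(a + b) + (t + u) *\<^sub>R y = (a + t *\<^sub>R y) + (b + u *\<^sub>R y)"
        by (simp add: algebra_simps)
      finally show ?thesis
        using sublinear_add[OF p, of "a + t *\<^sub>R y" "b + u *\<^sub>R y"] t u
        by (simp add: algebra_simps)
    qed
    then have "q (a + b) - s \<le> q b" if "s \<in> S a" for s
      unfolding q_def[of b] using that by (intro cInf_greatest ne)
    then have "q (a + b) - q b \<le> q a"
      unfolding q_def[of a] by (intro cInf_greatest ne) force
    then show "q (a + b) \<le> q a + q b"
      by simp
  next
    fix t :: real and x assume t: "t > 0"
    have "q (t *\<^sub>R x) / t \<le> s" if "s \<in> S x" for s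
    proof -
      obtain u where u: "u \<ge> 0" "s = p (x + u *\<^sub>R y) - u * p y"
        using \<open>s \<in> S x\<close> by (auto simp: S_def)
      have "q (t *\<^sub>R x) \<le> p (t *\<^sub>R x + (t * u) *\<^sub>R y) - (t * u) * p y"
        by (rule le) (use t u in simp)
      also have "t *\<^sub>R x + (t * u) *\<^sub>R y = t *\<^sub>R (x + u *\<^sub>R y)"
        by (simp add: algebra_simps)
      also have "p \<dots> - (t * u) * p y = t * s"
        by (simp add: sublinear_scale[OF p t] u right_diff_distrib)
      finally show ?thesis
        using t by (simp add: field_simps)
    qed
    then have "q (t *\<^sub>R x) / t \<le> q x"
      unfolding q_def[of x] by (intro cInf_greatest ne)
    then show "q (t *\<^sub>R x) \<le> t * q x"
      using t by (simp add: field_simps)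
  qed
  moreover have "q x \<le> p x" for x
    using le[of 0 x] by simp
  moreover have "q (- y) \<le> - p y"
    using le[of 1 "- y"] sublinear_zero[OF p] by simp
  ultimately show ?thesis
    by blast
qed

text \<open>The pointwise infimum works. The common majorant \<open>p\<close> keeps it finite, since
  \<open>q x \<ge> - q (- x) \<ge> - p (- x)\<close>. Subadditivity needs the chain: it lets two
  functionals, one near the infimum at \<open>a\<close> and one at \<open>b\<close>, be replaced by
  the smaller of them.\<close>

lemma sublinear_Inf_chain:
  fixes \<C> :: "('a::real_vector \<Rightarrow> real) set"
  assumes sub: "\<And>q. q \<in> \<C> \<Longrightarrow> sublinear q" and ne: "\<C> \<noteq> {}"
    and le: "\<And>q x. q \<in> \<C> \<Longrightarrow> q x \<le> p x"
    and chain: "\<And>q r. q \<in> \<C> \<Longrightarrow> r \<in> \<C> \<Longrightarrow> q \<le> r \<or> r \<le> q"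
  shows "\<exists>m. sublinear m \<and> (\<forall>q\<in>\<C>. m \<le> q)"
proof -
  define m where "m x = (INF q\<in>\<C>. q x)" for x
  have bdd: "bdd_below ((\<lambda>q. q x) ` \<C>)" for x
  proof (rule bdd_belowI2)
    fix q assume "q \<in> \<C>"
    then show "- p (- x) \<le> q x"
      using sublinear_ge_minus[OF sub, of q x] le[of q "- x"] by linarith
  qed
  have lower: "m x \<le> q x" if "q \<in> \<C>" for q x
    unfolding m_def by (rule cINF_lower[OF bdd that])
  have "sublinear m"
  proof (rule sublinearI)
    fix a b
    have "m (a + b) - q a \<le> r b" if qr: "q \<in> \<C>" "r \<in> \<C>" for q r
    proof -
      obtain s where s: "s \<in> \<C>" "s \<le> q" "s \<le> r"
        using chain[OF qr] qr by blast
      have "m (a + b) \<le> s a + s b"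
        using lower[OF s(1), of "a + b"] sublinear_add[OF sub[OF s(1)], of a b] by linarith
      then show ?thesis
        using s(2,3)[THEN le_funD, of a] s(2,3)[THEN le_funD, of b] by linarith
    qed
    then have "m (a + b) - q a \<le> m b" if "q \<in> \<C>" for q
      unfolding m_def[of b] using that ne by (intro cINF_greatest)
    then have "m (a + b) - m b \<le> m a"
      unfolding m_def[of a] using ne by (intro cINF_greatest) force+
    then show "m (a + b) \<le> m a + m b"
      by simp
  next
    fix t :: real and x assume t: "t > 0"
    have "m (t *\<^sub>R x) / t \<le> q x" if "q \<in> \<C>" for q
      using lower[OF that, of "t *\<^sub>R x"] sublinear_scale[OF sub[OF that] t, of x] t
      by (simp add: field_simps)
    then have "m (t *\<^sub>R x) / t \<le> m x"
      unfolding m_def[of x] using ne by (intro cINF_greatest)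
    then show "m (t *\<^sub>R x) \<le> t * m x"
      using t by (simp add: field_simps)
  qed
  then show ?thesis
    using lower by (auto simp: le_fun_def)
qed

lemma exists_minimal_sublinear:
  fixes p :: "'a::real_vector \<Rightarrow> real"
  assumes p: "sublinear p"
  shows "\<exists>m. sublinear m \<and> m \<le> p \<and> (\<forall>q. sublinear q \<longrightarrow> q \<le> m \<longrightarrow> q = m)"
proof -
  define A where "A = {q. sublinear q \<and> q \<le> p}"
  have "\<exists>m\<in>A. \<forall>q\<in>A. q \<le> m \<longrightarrow> q = m"
  \<comment> \<open>The order is reversed, so a maximal element for Zorn is a minimal functional;
    the empty chain is bounded by \<open>p\<close> itself.\<close>
  proof (rule predicate_Zorn)
    show "partial_order_on A (relation_of (\<lambda>q r. r \<le> q) A)"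
      by (auto simp: partial_order_on_def preorder_on_def refl_on_def trans_def antisym_def
          relation_of_def)
  next
    fix \<C> assume "\<C> \<in> Chains (relation_of (\<lambda>q r. r \<le> q) A)"
    then have chain: "q \<in> A \<and> (q \<le> r \<or> r \<le> q)" if "q \<in> \<C>" "r \<in> \<C>" for q r
      using that by (auto simp: Chains_def relation_of_def)
    show "\<exists>m\<in>A. \<forall>q\<in>\<C>. m \<le> q"
    proof (cases "\<C> = {}")
      case True
      then show ?thesis
        using p by (auto simp: A_def)
    next
      case False
      have "\<exists>m. sublinear m \<and> (\<forall>q\<in>\<C>. m \<le> q)"
        by (rule sublinear_Inf_chain[where p = p])
          (use chain False in \<open>auto simp: A_def dest: le_funD\<close>)
      then obtain m where m: "sublinear m" "\<forall>q\<in>\<C>. m \<le> q"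
        by blast
      moreover have "m \<in> A"
        using m False chain by (force simp: A_def intro: order_trans)
      ultimately show ?thesis
        by blast
    qed
  qed
  then show ?thesis
    unfolding A_def by (blast intro: order_trans)
qed

text \<open>Tilting cannot lower a minimal \<open>m\<close>, so \<open>m\<close> is odd.
  Subadditivity at \<open>- x\<close>, \<open>- y\<close> then becomes superadditivity at
  \<open>x\<close>, \<open>y\<close>, and oddness also handles negative scalars.\<close>

lemma minimal_sublinear_imp_linear:
  assumes m: "sublinear m" and min: "\<And>q. sublinear q \<Longrightarrow> q \<le> m \<Longrightarrow> q = m"
  shows "linear m"
proof -
  have minus: "m (- y) = - m y" for y
  proof -
    obtain q where "sublinear q" "\<forall>x. q x \<le> m x" "q (- y) \<le> - m y"
      using sublinear_tilt[OF m] by blast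
    then have "m (- y) \<le> - m y"
      using min[of q] by (auto simp: le_fun_def)
    then show ?thesis
      using sublinear_ge_minus[OF m, of y] by simp
  qed
  show ?thesis
  proof (rule linearI)
    fix x y
    show "m (x + y) = m x + m y"
      using sublinear_add[OF m, of x y] sublinear_add[OF m, of "- x" "- y"]
        minus[of x] minus[of y] minus[of "x + y"]
      by simp
  next
    fix t x
    show "m (t *\<^sub>R x) = t *\<^sub>R m x"
      using sublinear_scale_nonneg[OF m, of t x] sublinear_scale_nonneg[OF m, of "- t" x]
        minus[of "t *\<^sub>R x"]
      by (cases "t \<ge> 0") auto
  qed
qed

text \<open>Tilting \<open>p\<close> before minimizing secures contact at \<open>y\<close>: by
  linearity, \<open>\<phi> (- y) \<le> - p y\<close> reads
  \<open>p y \<le> \<phi> y\<close>.\<close>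

theorem Hahn_Banach_sublinear:
  fixes p :: "'a::real_vector \<Rightarrow> real"
  assumes "sublinear p"
  shows "\<exists>\<phi>. linear \<phi> \<and> (\<forall>x. \<phi> x \<le> p x) \<and> \<phi> y = p y"
proof -
  obtain q where q: "sublinear q" "\<forall>x. q x \<le> p x" "q (- y) \<le> - p y"
    using sublinear_tilt[OF assms] by blast
  obtain \<phi> where \<phi>: "sublinear \<phi>" "\<phi> \<le> q" "\<forall>r. sublinear r \<longrightarrow> r \<le> \<phi> \<longrightarrow> r = \<phi>"
    using exists_minimal_sublinear[OF q(1)] by blast
  have lin: "linear \<phi>"
    using minimal_sublinear_imp_linear \<phi> by blast
  have le: "\<phi> x \<le> p x" for x
    using \<phi>(2) q(2) by (meson le_funD order_trans)
  have "\<phi> (- y) \<le> - p y"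
    using \<phi>(2) q(3) by (meson le_funD order_trans)
  then have "\<phi> y = p y"
    using le[of y] linear_neg[OF lin, of y] by simp
  then show ?thesis
    using lin le by blast
qed

section \<open>Separation in locally convex spaces\<close>

text \<open>The functional \<open>p\<close> is the Minkowski gauge of \<open>W\<close>: it is at
  most 1 on \<open>W\<close> and at least 1 at \<open>y\<close>. A linear minorant touching it at
  \<open>y\<close> separates.\<close>

lemma convex_absorbing_separation:
  fixes W :: "'a::real_vector set"
  assumes W: "convex W" and absorb: "\<And>x. \<exists>t>0. \<exists>w\<in>W. x = t *\<^sub>R w" and y: "y \<notin> W"
  shows "\<exists>\<phi> :: 'a \<Rightarrow> real. linear \<phi> \<and> (\<forall>w\<in>W. \<phi> w \<le> 1) \<and> 1 \<le> \<phi> y"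
proof -
  define S where "S x = {t. 0 < t \<and> (\<exists>w\<in>W. x = t *\<^sub>R w)}" for x
  define p where "p x = Inf (S x)" for x
  have bdd: "bdd_below (S x)" for x
    by (rule bdd_belowI[of _ 0]) (auto simp: S_def)
  have ne: "S x \<noteq> {}" for x
    using absorb[of x] by (auto simp: S_def)
  have lower: "p x \<le> t" if "t \<in> S x" for x t
    unfolding p_def by (rule cInf_lower[OF that bdd])
  have "sublinear p"
  proof (rule sublinearI)
    fix a b
    have "p (a + b) - s \<le> r" if sr: "s \<in> S a" "r \<in> S b" for s r
    proof -
      obtain v w where vw: "s > 0" "v \<in> W" "a = s *\<^sub>R v" "r > 0" "w \<in> W" "b = r *\<^sub>R w"
        using sr by (auto simp: S_def)
      have "(s / (s + r)) *\<^sub>R v + (r / (s + r)) *\<^sub>R w \<in> W"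
        by (rule convexD[OF W]) (use vw in \<open>auto simp: add_divide_distrib[symmetric]\<close>)
      moreover have "a + b = (s + r) *\<^sub>R ((s / (s + r)) *\<^sub>R v + (r / (s + r)) *\<^sub>R w)"
        using vw by (simp add: scaleR_add_right)
      ultimately have "s + r \<in> S (a + b)"
        using vw by (auto simp: S_def)
      then show ?thesis
        using lower by fastforce
    qed
    then have "p (a + b) - s \<le> p b" if "s \<in> S a" for s
      unfolding p_def[of b] using that by (intro cInf_greatest ne)
    then have "p (a + b) - p b \<le> p a"
      unfolding p_def[of a] by (intro cInf_greatest ne) force
    then show "p (a + b) \<le> p a + p b"
      by simp
  next
    fix t :: real and x assume t: "t > 0"
    have "p (t *\<^sub>R x) / t \<le> s" if "s \<in> S x" for s
    proof -
      have "t * s \<in> S (t *\<^sub>R x)"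
        using that t by (auto simp: S_def)
      then show ?thesis
        using lower t by (fastforce simp: field_simps)
    qed
    then have "p (t *\<^sub>R x) / t \<le> p x"
      unfolding p_def[of x] by (intro cInf_greatest ne)
    then show "p (t *\<^sub>R x) \<le> t * p x"
      using t by (simp add: field_simps)
  qed
  then obtain \<phi> where \<phi>: "linear \<phi>" "\<forall>x. \<phi> x \<le> p x" "\<phi> y = p y"
    using Hahn_Banach_sublinear by blast
  have "\<phi> w \<le> 1" if "w \<in> W" for w
  proof -
    have "p w \<le> 1"
      by (rule lower) (use that in \<open>auto simp: S_def\<close>)
    then show ?thesis
      using \<phi>(2) by (meson order_trans)
  qed
  moreover have "1 \<le> p y"
    unfolding p_def
  proof (rule cInf_greatest[OF ne])
    fix t assume "t \<in> S y"
    then obtain w where w: "t > 0" "w \<in> W" "y = t *\<^sub>R w"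
      by (auto simp: S_def)
    \<comment> \<open>For \<open>t \<le> 1\<close> the point \<open>y = t *\<^sub>R w\<close> would
      lie on the segment from 0 to \<open>w\<close>, hence in \<open>W\<close>.\<close>
    have "0 \<in> W"
      using absorb[of 0] by auto
    then have "t *\<^sub>R w + (1 - t) *\<^sub>R 0 \<in> W" if "t \<le> 1"
      by (intro convexD[OF W]) (use w that in auto)
    then show "1 \<le> t"
      using w y by force
  qed
  ultimately show ?thesis
    using \<phi>(1,3) by force
qed

section \<open>Neighbourhoods of zero and continuity of linear functionals\<close>

lemma tendsto_scaleR_tvs:
  fixes g :: "'b \<Rightarrow> 'a::topological_real_vector"
  assumes "(f \<longlongrightarrow> c) F" "(g \<longlongrightarrow> x) F"
  shows "((\<lambda>s. f s *\<^sub>R g s) \<longlongrightarrow> c *\<^sub>R x) F"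
  using filterlim_compose[OF tendsto_scaleR_Pair filterlim_Pair[OF assms]] by simp

lemma open_absorbing:
  fixes U :: "'a::topological_real_vector set"
  assumes "open U" "0 \<in> U"
  shows "\<exists>t>0. t *\<^sub>R x \<in> U"
proof -
  have "((\<lambda>t. t *\<^sub>R x) \<longlongrightarrow> 0 *\<^sub>R x) (at_right 0)"
    by (intro tendsto_scaleR_tvs tendsto_ident_at tendsto_const)
  then have "eventually (\<lambda>t. t *\<^sub>R x \<in> U) (at_right 0)"
    using assms by (intro topological_tendstoD) auto
  then have "eventually (\<lambda>t. t *\<^sub>R x \<in> U \<and> t > 0) (at_right (0::real))"
    by (intro eventually_conj eventually_at_right_less)
  then show ?thesis
    using eventually_happens'[OF trivial_limit_at_right_real] by blast
qed

text \<open>A one-sided bound suffices because both signs of a scaled increment eventually lie in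
  \<open>U\<close>, even if \<open>U\<close> is not symmetric.\<close>

lemma linear_continuous_on_tvs:
  fixes \<phi> :: "'a::topological_real_vector \<Rightarrow> real"
  assumes lin: "linear \<phi>" and U: "open U" "0 \<in> U" and bound: "\<And>u. u \<in> U \<Longrightarrow> \<phi> u \<le> 1"
  shows "continuous_on UNIV \<phi>"
proof -
  have "(\<phi> \<longlongrightarrow> \<phi> x) (at x)" for x
  proof (rule tendstoI)
    fix e :: real assume e: "e > 0"
    have ev: "eventually (\<lambda>y. k *\<^sub>R (y - x) \<in> U) (at x)" for k
    proof -
      have "((\<lambda>y. k *\<^sub>R (y - x)) \<longlongrightarrow> k *\<^sub>R (x - x)) (at x)"
        by (intro tendsto_scaleR_tvs tendsto_intros)
      then show ?thesis
        using U by (intro topological_tendstoD) auto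
    qed
    \<comment> \<open>The factor 2 yields the bound \<open>e / 2\<close>, hence strict inequality
      with \<open>e\<close>.\<close>
    have "eventually (\<lambda>y. (2 / e) *\<^sub>R (y - x) \<in> U \<and> (- 2 / e) *\<^sub>R (y - x) \<in> U) (at x)"
      by (intro eventually_conj ev)
    then show "eventually (\<lambda>y. dist (\<phi> y) (\<phi> x) < e) (at x)"
    proof eventually_elim
      case (elim y)
      then have "2 / e * (\<phi> y - \<phi> x) \<le> 1" "- 2 / e * (\<phi> y - \<phi> x) \<le> 1"
        using bound linear_scale[OF lin] linear_diff[OF lin] by (metis real_scaleR_def)+
      then have "\<bar>\<phi> y - \<phi> x\<bar> \<le> e / 2"
        using e by (simp add: field_simps abs_if)
      then show ?case
        using e by (simp add: dist_real_def)
    qed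
  qed
  then show ?thesis
    by (simp add: continuous_on_def)
qed

text \<open>With a convex neighbourhood \<open>U\<close> of 0 such that \<open>U + z\<close> misses
  \<open>K\<close>, the set \<open>W = U + (a0 - K)\<close> is convex and omits
  \<open>a0 - z\<close>. The gauge lemma gives
  \<open>\<phi> (u + a0 - a) \<le> \<phi> (a0 - z)\<close>, that is,
  \<open>\<phi> z + \<phi> u \<le> \<phi> a\<close> for all \<open>u\<close> in \<open>U\<close> and
  \<open>a\<close> in \<open>K\<close>.\<close>

theorem separation_closure_convex:
  fixes K :: "'a::locally_convex_space set"
  assumes K: "convex K" "K \<noteq> {}" and z: "z \<notin> closure K"
  shows "\<exists>\<phi>\<in>topological_dual. \<exists>c. \<phi> z < c \<and> (\<forall>a\<in>K. c \<le> \<phi> a)"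
proof -
  obtain V where V: "open V" "convex V" "z \<in> V" "V \<subseteq> - closure K"
    using locally_convex[of "- closure K" z] z by auto
  define U where "U = (\<lambda>u. u + z) -` V"
  have contV: "continuous_on UNIV (\<lambda>u. u + z)"
    by (intro continuous_intros)
  have U: "open U" "0 \<in> U"
    using V open_vimage[OF V(1) contV] by (simp_all add: U_def)
  have "U = (\<lambda>v. v - z) ` V"
    unfolding U_def by (force simp: image_iff)
  then have convU: "convex U"
    using convex_translation_subtract_eq V(2) by metis
  obtain a0 where a0: "a0 \<in> K"
    using K by blast
  define W where "W = (\<Union>u\<in>U. \<Union>b \<in> (\<lambda>a. a0 - a) ` K. {u + b})"
  have "(\<lambda>a. a0 - a) ` K = (\<lambda>v. a0 + v) ` uminus ` K"
    by (auto simp: image_image)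
  then have "convex ((\<lambda>a. a0 - a) ` K)"
    using convex_negations[OF K(1)] convex_translation by metis
  then have convW: "convex W"
    unfolding W_def by (rule convex_sums[OF convU])
  \<comment> \<open>The base point \<open>a0\<close> puts 0 into \<open>a0 - K\<close>, so
    \<open>W\<close> inherits absorption from \<open>U\<close>.\<close>
  have UW: "u \<in> W" if "u \<in> U" for u
    unfolding W_def using that a0 by force
  have "\<exists>t>0. \<exists>w\<in>W. x = t *\<^sub>R w" for x
  proof -
    obtain t where "t > 0" "t *\<^sub>R x \<in> U"
      using open_absorbing[OF U] by blast
    then show ?thesis
      using UW by (intro exI[of _ "inverse t"]) (auto intro!: bexI[of _ "t *\<^sub>R x"])
  qed
  moreover have "a0 - z \<notin> W"
  proof
    assume "a0 - z \<in> W"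
    then obtain u a where ua: "u \<in> U" "a \<in> K" "a0 - z = u + (a0 - a)"
      unfolding W_def by auto
    then have "a = u + z"
      by (simp add: algebra_simps)
    then show False
      using ua V(4) closure_subset by (auto simp: U_def)
  qed
  ultimately obtain \<phi> :: "'a \<Rightarrow> real" where lin: "linear \<phi>"
    and le: "\<forall>w\<in>W. \<phi> w \<le> 1" and ge: "1 \<le> \<phi> (a0 - z)"
    using convex_absorbing_separation[OF convW] by blast
  have dual: "\<phi> \<in> topological_dual"
    using linear_continuous_on_tvs[OF lin U] le UW lin by (auto simp: topological_dual_def)
  \<comment> \<open>This point of \<open>U\<close> has a positive value under \<phi>, which becomes
    the strict gap between \<open>z\<close> and \<open>K\<close>.\<close>
  obtain t where t: "t > 0" "t *\<^sub>R (a0 - z) \<in> U"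
    using open_absorbing[OF U] by blast
  have pos: "\<phi> (t *\<^sub>R (a0 - z)) > 0"
    using t ge by (simp add: linear_scale[OF lin])
  have "\<phi> z + \<phi> (t *\<^sub>R (a0 - z)) \<le> \<phi> a" if "a \<in> K" for a
  proof -
    have "t *\<^sub>R (a0 - z) + (a0 - a) \<in> W"
      unfolding W_def using t(2) that by blast
    then have "\<phi> (t *\<^sub>R (a0 - z) + (a0 - a)) \<le> \<phi> (a0 - z)"
      using le ge by force
    then show ?thesis
      by (simp add: linear_add[OF lin] linear_diff[OF lin])
  qed
  with dual pos show ?thesis
    by (intro bexI[of _ \<phi>] exI[of _ "\<phi> z + \<phi> (t *\<^sub>R (a0 - z))"]) auto
qed

section \<open>Half-spaces and the Lagrangian\<close>

lemma convex_halfspace_linear_ge: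
  assumes "linear (\<phi> :: 'a::real_vector \<Rightarrow> real)"
  shows "convex {x. c \<le> \<phi> x}"
  using convex_linear_vimage[OF assms, of "{c..}"] by (simp add: vimage_def)

lemma closed_halfspace_dual_ge: "\<phi> \<in> topological_dual \<Longrightarrow> closed {x. c \<le> \<phi> x}"
  by (intro closed_Collect_le) (auto simp: topological_dual_def)

lemma \<G>_inf_subset_halfspace:
  assumes "\<phi> \<in> topological_dual" "\<And>A a. A \<in> \<A> \<Longrightarrow> a \<in> A \<Longrightarrow> c \<le> \<phi> a"
  shows "\<G>_inf \<A> \<subseteq> {x. c \<le> \<phi> x}"
  unfolding \<G>_inf_def
  by (intro closure_minimal hull_minimal closed_halfspace_dual_ge convex_halfspace_linear_ge)
    (use assms in \<open>auto simp: topological_dual_def\<close>)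

lemma subset_\<G>_inf: "A \<in> \<A> \<Longrightarrow> A \<subseteq> \<G>_inf \<A>"
  unfolding \<G>_inf_def
  by (rule order_trans[OF Union_upper order_trans[OF hull_subset closure_subset]])

lemma \<G>_inf_mono: "\<A> \<subseteq> \<B> \<Longrightarrow> \<G>_inf \<A> \<subseteq> \<G>_inf \<B>"
  unfolding \<G>_inf_def by (intro closure_mono hull_mono Union_mono)

lemma \<G>_add_cone:
  assumes "A \<in> \<G> C" "a \<in> A" "c \<in> C"
  shows "a + c \<in> A"
proof -
  have "A + C \<subseteq> closure (convex hull (A + C))"
    by (rule order_trans[OF hull_subset closure_subset])
  also have "\<dots> = A"
    using assms(1) by (simp add: \<G>_def)
  finally show ?thesis
    using assms(2,3) by (blast intro: set_plus_intro)
qed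

text \<open>From a point \<open>a\<close> of some \<open>A\<close> in \<A>, every ray in a direction
  of \<open>C\<close> stays in \<open>A\<close>. As \<phi> is bounded below there, it cannot be
  negative on \<open>C\<close>.\<close>

lemma \<G>_inf_separation:
  fixes C :: "'a::locally_convex_space set"
  assumes cone: "conic C" and \<A>: "\<A> \<subseteq> \<G> C" and ne: "\<Union>\<A> \<noteq> {}" and z: "z \<notin> \<G>_inf \<A>"
  shows "\<exists>\<phi>\<in>dual_cone C - {\<lambda>_. 0}. \<exists>c. \<phi> z < c \<and> (\<forall>a\<in>\<G>_inf \<A>. c \<le> \<phi> a)"
proof -
  obtain \<phi> c where \<phi>: "\<phi> \<in> topological_dual" "\<phi> z < c" "\<forall>a\<in>convex hull \<Union>\<A>. c \<le> \<phi> a"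
    using separation_closure_convex[of "convex hull \<Union>\<A>" z] z ne
    by (auto simp: \<G>_inf_def convex_convex_hull)
  have lin: "linear \<phi>"
    using \<phi>(1) by (simp add: topological_dual_def)
  have ge: "c \<le> \<phi> a" if "A \<in> \<A>" "a \<in> A" for A a
    using \<phi>(3) that hull_subset[of "\<Union>\<A>" convex] by blast
  obtain A a where a: "A \<in> \<A>" "a \<in> A"
    using ne by blast
  have "0 \<le> \<phi> d" if d: "d \<in> C" for d
  proof (rule ccontr)
    assume neg: "\<not> 0 \<le> \<phi> d"
    \<comment> \<open>Chosen so that \<phi> takes the value \<open>c - 1\<close> at
      \<open>a + t *\<^sub>R d\<close>, below its bound.\<close>
    define t where "t = (c - \<phi> a - 1) / \<phi> d"
    have "t \<ge> 0"
      unfolding t_def using neg ge[OF a] by (intro divide_nonpos_neg) auto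
    then have "a + t *\<^sub>R d \<in> A"
      using \<G>_add_cone a d \<A> cone by (metis conic_def subsetD)
    then have "c \<le> \<phi> a + t * \<phi> d"
      using ge[OF a(1)] linear_add[OF lin] linear_scale[OF lin] by force
    then show False
      using neg by (simp add: t_def)
  qed
  moreover have "\<phi> \<noteq> (\<lambda>_. 0)"
    using \<phi>(2) ge[OF a] by auto
  moreover have "\<forall>a\<in>\<G>_inf \<A>. c \<le> \<phi> a"
    using \<G>_inf_subset_halfspace[OF \<phi>(1), of \<A> c] ge by blast
  ultimately show ?thesis
    using \<phi> by (auto simp: dual_cone_def)
qed

text \<open>Since \<open>0 \<in> g x\<close>, the second summand of the Lagrangian contains 0, and
  adding a set containing 0 only enlarges \<open>f x\<close>.\<close>

lemma subset_Lagrangian: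
  assumes "0 \<in> g x" "linear ys" "linear zs"
  shows "f x \<subseteq> Lagrangian f g x ys zs"
proof -
  have "0 \<in> S_map ys zs 0"
    using assms by (simp add: S_map_def linear_0)
  then have "0 \<in> \<G>_inf (S_map ys zs ` g x)"
    using subset_\<G>_inf[OF imageI[OF assms(1), of "S_map ys zs"]] by blast
  then have "f x \<subseteq> f x + \<G>_inf (S_map ys zs ` g x)"
    by (subst add.commute) (rule set_zero_plus2)
  also have "\<dots> \<subseteq> Lagrangian f g x ys zs"
    unfolding Lagrangian_def closed_sum_def by (rule closure_subset)
  finally show ?thesis .
qed

text \<open>With this, \<open>dual_cone C\<close> differing from the singleton of zero yields a
  nonzero member.\<close>

lemma zero_in_dual_cone: "(\<lambda>_. 0) \<in> dual_cone C"
  by (simp add: dual_cone_def topological_dual_def linearI)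

section \<open>Infimality of \<open>M\<close> from the two dual equations\<close>

theorem proposition6p7:
  fixes C :: "'z::locally_convex_space set"
    and D :: "'y::locally_convex_space set"
    and f :: "'x::locally_convex_space \<Rightarrow> 'z set"
    and g :: "'x \<Rightarrow> 'y set"
    and M :: "'x set"
  assumes "convex_cone C" and "0 \<in> C"
    and "convex_cone D" and "0 \<in> D"
    and "dual_cone C \<noteq> {\<lambda>_. 0}"
    and "\<And>x. f x \<in> \<G> C"
    and "\<And>x. g x \<in> \<G> D"
    and "M \<subseteq> feasible_set g" and "M \<noteq> {}"
    and "\<forall>zs \<in> dual_cone C - {\<lambda>_. 0}. \<exists>ys \<in> dual_cone D.
      inf_translation f 0 M \<oplus>\<^sub>c\<^sub>l \<G>_inf (S_map ys zs ` inf_translation g 0 M)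
        = \<G>_inf (range (\<lambda>x. Lagrangian f g x ys zs)) \<and>
      \<G>_inf (S_map ys zs ` inf_translation g 0 M) = H_plus zs"
  shows "infimizer f g M"
proof -
  let ?A = "\<G>_inf (f ` M)"
  have f_le: "f x \<subseteq> ?A \<oplus>\<^sub>c\<^sub>l H_plus zs"
    if zs: "zs \<in> dual_cone C - {\<lambda>_. 0}" and x: "x \<in> feasible_set g" for zs x
  proof -
    obtain ys where ys: "ys \<in> dual_cone D"
      and eq: "inf_translation f 0 M \<oplus>\<^sub>c\<^sub>l \<G>_inf (S_map ys zs ` inf_translation g 0 M)
        = \<G>_inf (range (\<lambda>x. Lagrangian f g x ys zs))"
      and H: "\<G>_inf (S_map ys zs ` inf_translation g 0 M) = H_plus zs"
      using assms(10) zs by blast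
    have "f x \<subseteq> Lagrangian f g x ys zs"
      using x ys zs
      by (intro subset_Lagrangian) (auto simp: feasible_set_def dual_cone_def topological_dual_def)
    also have "\<dots> \<subseteq> \<G>_inf (range (\<lambda>x. Lagrangian f g x ys zs))"
      by (rule subset_\<G>_inf) simp
    \<comment> \<open>At base point 0 the translation of \<open>f\<close> is \<open>?A\<close>, and
      the second equation turns the other summand into \<open>H_plus zs\<close>.\<close>
    also have "\<dots> = ?A \<oplus>\<^sub>c\<^sub>l H_plus zs"
      using eq H by (simp add: inf_translation_def)
    finally show ?thesis .
  qed
  have "\<G>_inf (f ` feasible_set g) \<subseteq> ?A"
  \<comment> \<open>If all values on \<open>M\<close> are empty, the separation lemma does not
    apply. Then a single nonzero \<open>zs\<close> suffices: \<open>?A\<close> is empty, hence so is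
    its sum with \<open>H_plus zs\<close>, which contains every feasible value.\<close>
  proof (cases "\<Union>(f ` M) = {}")
    case True
    obtain zs where "zs \<in> dual_cone C - {\<lambda>_. 0}"
      using assms(5) zero_in_dual_cone by blast
    moreover have "?A = {}"
      using True by (simp add: \<G>_inf_def)
    ultimately have "f x = {}" if "x \<in> feasible_set g" for x
      using f_le[OF _ that] by (fastforce simp: closed_sum_def set_plus_def)
    then have "\<Union>(f ` feasible_set g) = {}"
      by simp
    then show ?thesis
      by (simp add: \<G>_inf_def)
  next
    case False
    show ?thesis
    proof
      fix z assume z: "z \<in> \<G>_inf (f ` feasible_set g)"
      show "z \<in> ?A"
      proof (rule ccontr)
        assume "z \<notin> ?A"
        moreover have "conic C" "f ` M \<subseteq> \<G> C"
          using assms(1,6) by (auto simp: convex_cone_def)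
        ultimately obtain \<phi> c where \<phi>: "\<phi> \<in> dual_cone C - {\<lambda>_. 0}" "\<phi> z < c"
          and c: "\<forall>a\<in>?A. c \<le> \<phi> a"
          using \<G>_inf_separation[of C "f ` M" z] False by blast
        have dual: "\<phi> \<in> topological_dual" and lin: "linear \<phi>"
          using \<phi>(1) by (auto simp: dual_cone_def topological_dual_def)
        \<comment> \<open>Adding points where \<phi> is nonnegative preserves the lower bound
          \<open>c\<close>, and the half-space is closed.\<close>
        have "?A \<oplus>\<^sub>c\<^sub>l H_plus \<phi> \<subseteq> {x. c \<le> \<phi> x}"
          unfolding closed_sum_def
        proof (intro closure_minimal closed_halfspace_dual_ge[OF dual] subsetI)
          fix x assume "x \<in> ?A + H_plus \<phi>"
          then obtain a h where "x = a + h" "a \<in> ?A" "0 \<le> \<phi> h"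
            by (auto simp: set_plus_def H_plus_def)
          then show "x \<in> {x. c \<le> \<phi> x}"
            using c linear_add[OF lin] by force
        qed
        \<comment> \<open>Here \<open>z\<close> need not belong to a single \<open>f x\<close>; the
          closed convex half-space contains all feasible values and therefore their infimum.\<close>
        then have "\<G>_inf (f ` feasible_set g) \<subseteq> {x. c \<le> \<phi> x}"
          using f_le[OF \<phi>(1)] by (intro \<G>_inf_subset_halfspace[OF dual]) fast
        then show False
          using z \<phi>(2) by auto
      qed
    qed
  qed
  moreover have "?A \<subseteq> \<G>_inf (f ` feasible_set g)"
    by (intro \<G>_inf_mono image_mono assms(8))
  ultimately show ?thesis
    by (simp add: infimizer_def)
qed

end
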